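(* Let $\mu\in(0,1]$ and let $p_1<p_2$ be finite real numbers. Let $u_0$ be a tempered distribution on $\mathbb{R}$ whose Fourier transform $\mathcal{F}u_0$ is a function with $\operatorname{supp}\mathcal{F}u_0=[p_1,p_2]$ and $$\mathcal{F}u_0(p)=(p-p_1)^{\mu-1}\,\tilde u(p)\qquad\text{for all }p\in(p_1,p_2],$$ where $\tilde u:[p_1,p_2]\to\mathbb{C}$ is continuous on $[p_1,p_2]$, differentiable on $(p_1,p_2)$ with $\tilde u'\in L^1(p_1,p_2)$, and $\tilde u(p_1)\neq0$ if $\mu\neq1$. Let $u_S:(0,+\infty)\times\mathbb{R}\to\mathbb{C}$ be the solution of the free Schrödinger equation $[i\partial_t+\partial_x^2]u=0$, $u(0,\cdot)=u_0$, i.e. $$u_S(t,x)=\frac{1}{2\pi}\int_{p_1}^{p_2}\mathcal{F}u_0(p)\,e^{-itp^2+ixp}\,dp .$$ Then $$\forall\,t\geqslant1\qquad \|u_S(t,\cdot)\|_{L^\infty(\mathbb{R})}\leqslant c(u_0)\,t^{-\frac\mu2},$$ where, for any fixed choice of finite real numbers $\tilde p_1<p_1$ and $\tilde p_2>p_2$, one may take $$c(u_0):=\frac{5}{2\pi\mu}\,\|\tilde u\|_{L^\infty(p_1,p_2)}+\frac{1}{2\pi}\Big(4\|\tilde u\|_{L^\infty(p_1,p_2)}+\|\tilde u'\|_{L^1(p_1,p_2)}\Big)\left(1+\frac{1}{2(p_1-\tilde p_1)}+\frac{1}{2(\tilde p_2-p_2)}\right),$$ and the decay rate $t^{-\mu/2}$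 is optimal, in the sense that $t^{\mu/2}\,\|u_S(t,\cdot)\|_{L^\infty(\mathbb{R})}$ does not tend to $0$ as $t\to+\infty$.
   Context: Fourier transform convention: $\mathcal{F}v(p)=\int_{\mathbb{R}}v(x)e^{-ixp}\,dx$, extended to tempered distributions. Under the hypotheses $\mathcal{F}u_0$ is integrable, so the formula for $u_S$ is well defined for all $t>0$, $x\in\mathbb{R}$. *)

theory Defs
  imports "HOL-Probability.Essential_Supremum"
begin

definition iter_deriv :: "nat \<Rightarrow> (real \<Rightarrow> complex) \<Rightarrow> real \<Rightarrow> complex" where
  "iter_deriv n f = ((\<lambda>h x. vector_derivative h (at x)) ^^ n) f"

definition smooth :: "(real \<Rightarrow> complex) \<Rightarrow> bool" where
  "smooth f \<longleftrightarrow> (\<forall>n x. iter_deriv n f differentiable (at x))"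

definition schwartz :: "(real \<Rightarrow> complex) set" where
  "schwartz = {f. smooth f \<and> (\<forall>a b. bounded (range (\<lambda>x. x ^ a *\<^sub>R iter_deriv b f x)))}"

definition schwartz_seminorm :: "nat \<Rightarrow> nat \<Rightarrow> (real \<Rightarrow> complex) \<Rightarrow> real" where
  "schwartz_seminorm a b f = (SUP x. norm (x ^ a *\<^sub>R iter_deriv b f x))"

text \<open>
  Tempered distributions are functionals on all of \<open>real \<Rightarrow> complex\<close>, but only their values on
  \<^const>\<open>schwartz\<close> matter. The bound by finitely many seminorms is continuity
  for the Frechet topology of the Schwartz space.
\<close>

definition tempered_distribution :: "((real \<Rightarrow> complex) \<Rightarrow> complex) \<Rightarrow> bool" where
  "tempered_distribution T \<longleftrightarrow>
     (\<forall>f\<in>schwartz. \<forall>g\<in>schwartz. T (\<lambda>x. f x + g x) = T f + T g) \<and>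
     (\<forall>c. \<forall>f\<in>schwartz. T (\<lambda>x. c * f x) = c * T f) \<and>
     (\<exists>C N. \<forall>f\<in>schwartz. norm (T f) \<le> C * (\<Sum>a\<le>N. \<Sum>b\<le>N. schwartz_seminorm a b f))"

definition fourier :: "(real \<Rightarrow> complex) \<Rightarrow> real \<Rightarrow> complex" where
  "fourier f p = (LINT x|lebesgue. f x * exp (- \<i> * of_real x * of_real p))"

definition fourier_distribution ::
    "((real \<Rightarrow> complex) \<Rightarrow> complex) \<Rightarrow> (real \<Rightarrow> complex) \<Rightarrow> complex" where
  "fourier_distribution T = (\<lambda>f. T (fourier f))"

definition test_functions :: "real set \<Rightarrow> (real \<Rightarrow> complex) set" where
  "test_functions U =
     {f. smooth f \<and> compact (closure {x. f x \<noteq> 0}) \<and> closure {x. f x \<noteq> 0} \<subseteq> U}"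

text \<open>
  A distribution is a function if it is integration against a locally integrable function.
  As usual this is tested on compactly supported functions only, since a Schwartz function
  times a locally integrable function need not be integrable.
\<close>

definition distribution_is_function ::
    "((real \<Rightarrow> complex) \<Rightarrow> complex) \<Rightarrow> (real \<Rightarrow> complex) \<Rightarrow> bool" where
  "distribution_is_function T g \<longleftrightarrow>
     (\<forall>K. compact K \<longrightarrow> g absolutely_integrable_on K) \<and>
     (\<forall>f\<in>test_functions UNIV. T f = (LINT p|lebesgue. g p * f p))"

definition distribution_support :: "((real \<Rightarrow> complex) \<Rightarrow> complex) \<Rightarrow> real set" where
  "distribution_support T = - \<Union> {U. open U \<and> (\<forall>f\<in>test_functions U. T f = 0)}"

text \<open>
  The norms take values in \<^typ>\<open>ennreal\<close>, so that an infinite norm is \<open>\<infinity>\<close> and no bound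
  holds by a junk value.
\<close>

definition Linf_norm :: "real set \<Rightarrow> (real \<Rightarrow> complex) \<Rightarrow> ennreal" where
  "Linf_norm S f = esssup (lebesgue_on S) (\<lambda>x. ennreal (norm (f x)))"

definition L1_norm :: "real set \<Rightarrow> (real \<Rightarrow> complex) \<Rightarrow> ennreal" where
  "L1_norm S f = (\<integral>\<^sup>+x. ennreal (norm (f x)) \<partial>lebesgue_on S)"

text \<open>
  The solution at time \<open>t > 0\<close> of \<open>i u\<^sub>t + u\<^sub>x\<^sub>x = 0\<close> whose initial datum has Fourier
  transform \<open>g\<close>, supported in \<open>[p1, p2]\<close>, given by the Fourier inversion formula.
\<close>

definition schroedinger_solution ::
    "real \<Rightarrow> real \<Rightarrow> (real \<Rightarrow> complex) \<Rightarrow> real \<Rightarrow> real \<Rightarrow> complex" where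
  "schroedinger_solution p1 p2 g t x =
     1 / (2 * of_real pi) *
       (LINT p:{p1..p2}|lebesgue.
          g p * exp (- \<i> * of_real t * of_real p ^ 2 + \<i> * of_real x * of_real p))"

definition decay_const ::
    "real \<Rightarrow> real \<Rightarrow> real \<Rightarrow> (real \<Rightarrow> complex) \<Rightarrow> real \<Rightarrow> real \<Rightarrow> ennreal" where
  "decay_const \<mu> p1 p2 v q1 q2 =
     ennreal (5 / (2 * pi * \<mu>)) * Linf_norm {p1<..<p2} v +
     ennreal (1 / (2 * pi)) *
       (4 * Linf_norm {p1<..<p2} v + L1_norm {p1<..<p2} (\<lambda>p. vector_derivative v (at p))) *
       ennreal (1 + 1 / (2 * (p1 - q1)) + 1 / (2 * (q2 - p2)))"

end

theory Submission
  imports Defs "HOL-Probability.Characteristic_Functions" "HOL-Real_Asymp.Real_Asymp"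
begin

text \<open>
  Write \<open>w(p) = (p - p\<^sub>1)\<^bsup>\<mu> - 1\<^esup>\<close> and \<open>\<delta> = t\<^bsup>-1/2\<^esup>\<close>. The phase \<open>x p - t p\<^sup>2\<close> is stationary at
  \<open>c = x / (2 t)\<close>. For the upper bound, the parts \<open>[p\<^sub>1, p\<^sub>1 + \<delta>]\<close> and \<open>\<bar>p - c\<bar> \<le> \<delta>\<close> of the integral are
  estimated trivially; on the remaining two intervals \<open>w \<le> \<delta>\<^bsup>\<mu> - 1\<^esup>\<close> and the derivative of the phase is
  at least \<open>2 / \<delta>\<close> in absolute value, so one integration by parts suffices.

  For optimality, averaging \<open>u\<^sub>S(t, 2 t q + \<surd>(2 t) z)\<close>, up to a unimodular factor, over a standard normal
  \<open>z\<close> yields the absolutely convergent integral of \<open>w v e\<^bsup>-(1 + i) t (p - q)\<^sup>2\<^esup>\<close>, which therefore bounds the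
  sup norm from below. With \<open>q = p\<^sub>1\<close> if \<open>\<mu> < 1\<close>, and any interior \<open>q\<close> with \<open>v(q) \<noteq> 0\<close> if \<open>\<mu> = 1\<close>, it is of
  order \<open>t\<^bsup>-\<mu>/2\<^esup>\<close>: since \<open>\<bar>e\<^bsup>-i s\<^esup> - 1\<bar> \<le> s\<close>, replacing \<open>1 + i\<close> by \<open>1\<close> costs at most the second moment
  of the Gaussian weight, which is at most half of its mass.
\<close>

section \<open>Essential suprema and nonstationary phase\<close>

text \<open>A strict superlevel set of a continuous function is open in \<open>S\<close>; above the
  essential supremum it is also null, and a nonempty open set is never null.\<close>

lemma norm_le_Linf_norm:
  fixes f :: "real \<Rightarrow> complex"
  assumes S: "open S" and f: "continuous_on S f" and x: "x \<in> S"
  shows "ennreal (norm (f x)) \<le> Linf_norm S f"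
proof (rule ccontr)
  define z where "z = Linf_norm S f"
  define U where "U = {y \<in> S. z < ennreal (norm (f y))}"
  assume "\<not> ?thesis"
  then have "x \<in> U" using x by (auto simp: U_def z_def)
  have "continuous_on S (\<lambda>y. ennreal (norm (f y)))"
    by (intro continuous_on_ennreal continuous_on_norm f)
  then have "open (S \<inter> (\<lambda>y. ennreal (norm (f y))) -` {z<..})"
    using S by (intro continuous_open_preimage) auto
  also have "S \<inter> (\<lambda>y. ennreal (norm (f y))) -` {z<..} = U"
    by (auto simp: U_def)
  finally have "open U" .
  have "AE y in lebesgue_on S. ennreal (norm (f y)) \<le> z"
    unfolding z_def Linf_norm_def by (rule esssup_AE)
  then have "AE y in lebesgue. y \<in> S \<longrightarrow> ennreal (norm (f y)) \<le> z"
    using S by (subst (asm) AE_restrict_space_iff) (auto simp: borel_open)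
  then have "AE y in lebesgue. y \<notin> U"
    by eventually_elim (auto simp: U_def not_less)
  then have "negligible U"
    using \<open>open U\<close> by (auto simp: negligible_iff_null_sets AE_iff_null_sets borel_open)
  then show False
    using \<open>open U\<close> \<open>x \<in> U\<close> open_not_negligible by blast
qed

text \<open>The hypothesis \<open>kE\<close> makes \<open>k\<close> minus the reciprocal of the
  phase derivative. In the factor \<open>4 * M\<close>, the two boundary terms give
  \<open>2 * M\<close>, and the terms with \<open>w'\<close> and \<open>k'\<close> give
  \<open>M\<close> each: both functions decrease, so their variations are \<open>w l - w r\<close>
  and \<open>k l - k r\<close>, bounded by \<open>W\<close> and \<open>K\<close>.\<close>

lemma oscillatory_integral_by_parts:
  fixes E E' v v' :: "real \<Rightarrow> complex" and w w' k k' :: "real \<Rightarrow> real"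
  assumes lr: "l \<le> r"
    and cont: "continuous_on {l..r} E" "continuous_on {l..r} v" "continuous_on {l..r} w"
      "continuous_on {l..r} k"
    and E: "\<And>p. p \<in> {l<..<r} \<Longrightarrow> (E has_vector_derivative E' p) (at p)"
    and v: "\<And>p. p \<in> {l<..<r} \<Longrightarrow> (v has_vector_derivative v' p) (at p)"
    and w: "\<And>p. p \<in> {l<..<r} \<Longrightarrow> (w has_vector_derivative w' p) (at p)"
    and k: "\<And>p. p \<in> {l<..<r} \<Longrightarrow> (k has_vector_derivative k' p) (at p)"
    and kE: "\<And>p. p \<in> {l<..<r} \<Longrightarrow> k p *\<^sub>R E' p = - (\<i> * E p)"
    and anti: "\<And>p. p \<in> {l<..<r} \<Longrightarrow> w' p \<le> 0" "\<And>p. p \<in> {l<..<r} \<Longrightarrow> k' p \<le> 0"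
    and bE: "\<And>p. p \<in> {l..r} \<Longrightarrow> norm (E p) \<le> 1"
    and bv: "\<And>p. p \<in> {l..r} \<Longrightarrow> norm (v p) \<le> M"
    and bw: "\<And>p. p \<in> {l..r} \<Longrightarrow> 0 \<le> w p \<and> w p \<le> W"
    and bk: "\<And>p. p \<in> {l..r} \<Longrightarrow> \<bar>k p\<bar> \<le> K" "k l - k r \<le> K"
    and v'_int: "(\<lambda>p. norm (v' p)) integrable_on {l..r}" 
  shows "norm (integral {l..r} (\<lambda>p. w p *\<^sub>R v p * E p))
           \<le> W * K * (4 * M + integral {l..r} (\<lambda>p. norm (v' p)))"
proof -
  let ?V = "integral {l..r} (\<lambda>p. norm (v' p))"
  have M0: "0 \<le> M" using bv[of l] lr by (force intro: order_trans[OF norm_ge_zero])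
  have W0: "0 \<le> W" using bw[of l] lr by force
  have K0: "0 \<le> K" using bk(1)[of l] lr by force
  \<comment> \<open>By \<open>kE\<close>, the derivative of \<open>H\<close> is the integrand plus
    \<open>R\<close>. The majorant \<open>D\<close> of \<open>R\<close> integrates explicitly, up to
    the norm of \<open>v'\<close>, because \<open>- w'\<close> and \<open>- k'\<close> are
    nonnegative and have known primitives.\<close>
  define H where "H p = \<i> * (E p * ((w p * k p) *\<^sub>R v p))" for p
  define R where "R p = \<i> * E p * ((w' p * k p + w p * k' p) *\<^sub>R v p + (w p * k p) *\<^sub>R v' p)" for p
  define D where "D p = W * K * norm (v' p) - (M * K) * w' p - (M * W) * k' p" for p
  have "((\<lambda>p. w p *\<^sub>R v p * E p + R p) has_integral (H r - H l)) {l..r}"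
  proof (rule fundamental_theorem_of_calculus_interior[OF lr])
    show "continuous_on {l..r} H"
      unfolding H_def by (intro continuous_intros cont)
    fix p assume p: "p \<in> {l<..<r}"
    have wk: "((\<lambda>p. w p * k p) has_real_derivative (w' p * k p + w p * k' p)) (at p)"
      using w[OF p] k[OF p]
      by (auto simp flip: has_real_derivative_iff_has_vector_derivative intro!: derivative_eq_intros)
    have rot: "\<i> * (- \<i> * X + Y) = X + \<i> * Y" for X Y :: complex
      by (simp add: ring_distribs)
    note wk[THEN has_vector_derivative_scaleR, OF v[OF p]]
    note has_vector_derivative_mult[OF E[OF p] this]
    note has_vector_derivative_mult_right[OF this, of "\<i>"]
    then have "(H has_vector_derivative
        (\<i> * (E' p * ((w p * k p) *\<^sub>R v p)
          + E p * ((w' p * k p + w p * k' p) *\<^sub>R v p + (w p * k p) *\<^sub>R v' p)))) (at p)"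
      unfolding H_def by (simp add: add_ac)
    also have "E' p * ((w p * k p) *\<^sub>R v p) = w p *\<^sub>R ((k p *\<^sub>R E' p) * v p)"
      by (simp add: scaleR_conv_of_real mult_ac)
    also have "\<dots> = - \<i> * (w p *\<^sub>R v p * E p)"
      unfolding kE[OF p] by (simp add: scaleR_conv_of_real mult_ac)
    finally show "(H has_vector_derivative w p *\<^sub>R v p * E p + R p) (at p)"
      unfolding R_def mult.assoc[of \<i>] by (simp only: rot)
  qed
  moreover have "((\<lambda>p. w p *\<^sub>R v p * E p) has_integral integral {l..r} (\<lambda>p. w p *\<^sub>R v p * E p)) {l..r}"
    by (intro integrable_integral integrable_continuous_interval continuous_intros cont)
  ultimately have "((\<lambda>p. w p *\<^sub>R v p * E p + R p - w p *\<^sub>R v p * E p) has_integral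
      (H r - H l - integral {l..r} (\<lambda>p. w p *\<^sub>R v p * E p))) {l..r}"
    by (rule has_integral_diff)
  then have R: "(R has_integral (H r - H l - integral {l..r} (\<lambda>p. w p *\<^sub>R v p * E p))) {l..r}"
    by (simp only: add_diff_cancel_left')
  have w_int: "(w' has_integral (w r - w l)) {l..r}"
    by (rule fundamental_theorem_of_calculus_interior[OF lr cont(3) w])
  have k_int: "(k' has_integral (k r - k l)) {l..r}"
    by (rule fundamental_theorem_of_calculus_interior[OF lr cont(4) k])
  have D: "(D has_integral (W * K * ?V - (M * K) * (w r - w l) - (M * W) * (k r - k l))) {l..r}"
    unfolding D_def
    by (intro has_integral_diff has_integral_mult_right integrable_integral v'_int w_int k_int)
  have RD: "norm (R p) \<le> D p" if p: "p \<in> {l<..<r}" for p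
  proof -
    have p': "p \<in> {l..r}" using p by auto
    note b = bE[OF p'] bv[OF p'] bw[OF p'] bk(1)[OF p'] anti[OF p]
    have "norm (R p) \<le> 1 * (norm ((w' p * k p + w p * k' p) *\<^sub>R v p) + norm ((w p * k p) *\<^sub>R v' p))"
      unfolding R_def norm_mult norm_minus_cancel
      by (intro mult_mono norm_triangle_ineq b) (auto intro: b)
    also have "\<dots> \<le> (-w' p * K + W * - k' p) * M + W * K * norm (v' p)"
    proof -
      have "\<bar>w' p * k p + w p * k' p\<bar> \<le> \<bar>w' p\<bar> * \<bar>k p\<bar> + \<bar>w p\<bar> * \<bar>k' p\<bar>"
        unfolding abs_mult[symmetric] by (rule abs_triangle_ineq)
      also have "\<dots> \<le> -w' p * K + W * - k' p"
        using b W0 by (intro add_mono mult_mono) auto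
      finally have 1: "\<bar>w' p * k p + w p * k' p\<bar> \<le> -w' p * K + W * - k' p" .
      have 2: "\<bar>w p * k p\<bar> \<le> W * K"
        unfolding abs_mult using b W0 by (intro mult_mono) auto
      have "0 \<le> -w' p * K + W * - k' p" using 1 by linarith
      then show ?thesis
        unfolding norm_scaleR mult_1
        using 1 2 b by (intro add_mono mult_mono) auto
    qed
    also have "\<dots> = D p" by (simp add: D_def algebra_simps)
    finally show ?thesis .
  qed
  have "norm (H r - H l - integral {l..r} (\<lambda>p. w p *\<^sub>R v p * E p))
     \<le> W * K * ?V - (M * K) * (w r - w l) - (M * W) * (k r - k l)"
  proof -
    \<comment> \<open>The estimate \<open>RD\<close> is available only where the derivatives are,
      hence the open interval.\<close>
    have "R integrable_on {l<..<r}" "D integrable_on {l<..<r}"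
      using R D has_integral_integrable integrable_on_Icc_iff_Ioo by blast+
    then have "norm (integral {l<..<r} R) \<le> integral {l<..<r} D"
      by (rule integral_norm_bound_integral) (rule RD)
    then show ?thesis
      unfolding integral_open_interval_real[symmetric] integral_unique[OF R] integral_unique[OF D] .
  qed
  also have "\<dots> = W * K * ?V + (M * K) * (w l - w r) + (M * W) * (k l - k r)"
    by (simp add: algebra_simps)
  also have "\<dots> \<le> W * K * ?V + (M * K) * W + (M * W) * K"
    using bk bw[of l] bw[of r] lr M0 W0 K0 by (intro add_mono mult_left_mono) auto
  finally have 1: "norm (H r - H l - integral {l..r} (\<lambda>p. w p *\<^sub>R v p * E p)) \<le> W * K * ?V + 2 * (W * K * M)"
    by (simp add: algebra_simps)
  have H: "norm (H p) \<le> W * K * M" if p: "p \<in> {l..r}" for p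
  proof -
    have "norm (H p) = norm (E p) * (w p * \<bar>k p\<bar> * norm (v p))"
      using bw[OF p] by (simp add: H_def norm_mult abs_mult)
    also have "\<dots> \<le> 1 * (W * K * M)"
      using bE[OF p] bv[OF p] bw[OF p] bk(1)[OF p] W0 K0 by (intro mult_mono) auto
    finally show ?thesis by simp
  qed
  have "norm (integral {l..r} (\<lambda>p. w p *\<^sub>R v p * E p))
     \<le> norm (H r) + norm (H l) + norm (H r - H l - integral {l..r} (\<lambda>p. w p *\<^sub>R v p * E p))"
  proof -
    have "norm (H r - H l - (H r - H l - I)) \<le> norm (H r) + norm (H l) + norm (H r - H l - I)" for I
      by (intro order_trans[OF norm_triangle_ineq4] add_right_mono norm_triangle_ineq4)
    moreover have "a - b - (a - b - I) = I" for a b I :: complex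
      by simp
    ultimately show ?thesis by metis
  qed
  also have "\<dots> \<le> W * K * M + W * K * M + (W * K * ?V + 2 * (W * K * M))"
    using lr by (intro add_mono 1 H) auto
  finally show ?thesis by (simp add: algebra_simps)
qed

lemma norm_exp_ii_minus_one_le: "norm (exp (\<i> * of_real x) - 1) \<le> \<bar>x\<bar>" for x :: real
proof -
  have "norm (exp (\<i> * of_real x) - 1) = 2 * \<bar>sin (x / 2)\<bar>"
    by (rule dist_exp_i_1)
  also have "\<dots> \<le> 2 * \<bar>x / 2\<bar>"
    by (intro mult_left_mono abs_sin_x_le_abs_x) auto
  finally show ?thesis by simp
qed

section \<open>The singular amplitude: integrability and the phase factor\<close>

text \<open>A real bound \<open>M\<close> on the closed interval keeps all estimates in the reals;
  extended norms enter only in the final theorem, where \<open>M\<close> becomes the maximum of the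
  norm of \<open>v\<close>.\<close>

locale singular_amplitude =
  fixes \<mu> p1 p2 :: real and v :: "real \<Rightarrow> complex" and M :: real
  assumes \<mu>: "0 < \<mu>" "\<mu> \<le> 1" and p12: "p1 < p2"
    and cont_v: "continuous_on {p1..p2} v"
    and diff_v: "\<And>p. p \<in> {p1<..<p2} \<Longrightarrow> v differentiable (at p)"
    and int_v': "(\<lambda>p. vector_derivative v (at p)) absolutely_integrable_on {p1<..<p2}"
    and bound_v: "\<And>p. p \<in> {p1..p2} \<Longrightarrow> norm (v p) \<le> M"
begin

definition L where "L = integral {p1<..<p2} (\<lambda>p. norm (vector_derivative v (at p)))"
definition w where "w p = (p - p1) powr (\<mu> - 1)"
definition E where "E t x p = exp (- \<i> * of_real t * of_real p ^ 2 + \<i> * of_real x * of_real p)"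

lemma M_nonneg: "0 \<le> M"
  using bound_v[of p1] p12 by (force intro: order_trans[OF norm_ge_zero])

lemma w_nonneg: "0 \<le> w p"
  by (simp add: w_def)

lemma norm_E [simp]: "norm (E t x p) = 1"
proof -
  have "E t x p = exp (\<i> * of_real (x * p - t * p ^ 2))"
    by (simp add: E_def algebra_simps)
  then show ?thesis by (simp only: norm_exp_i_times)
qed

lemma has_vector_derivative_E:
  "(E t x has_vector_derivative (\<i> * of_real (x - 2 * t * p) * E t x p)) (at p within S)"
  unfolding E_def
  by (rule has_vector_derivative_real_field)
     (auto intro!: derivative_eq_intros simp: algebra_simps)

lemma continuous_on_E: "continuous_on S (E t x)"
  unfolding E_def by (intro continuous_intros)

lemma has_integral_w:
  assumes "p1 \<le> b"
  shows "(w has_integral ((b - p1) powr \<mu> / \<mu>)) {p1..b}"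
proof -
  have "((\<lambda>x. x powr (\<mu> - 1)) has_integral ((b - p1) powr (\<mu> - 1 + 1) / (\<mu> - 1 + 1))) {0..b - p1}"
    using assms \<mu> by (intro has_integral_powr_from_0) auto
  from has_integral_affinity'[OF this[folded cbox_interval], of 1 "- p1"] show ?thesis
    by (simp add: w_def[abs_def] add.commute)
qed

lemma measurable_w [measurable]: "w \<in> borel_measurable borel"
  unfolding w_def[abs_def] by measurable

lemma measurable_wv: "(\<lambda>p. w p *\<^sub>R v p) \<in> borel_measurable (lebesgue_on {p1..p2})"
proof (rule borel_measurable_scaleR)
  show "w \<in> borel_measurable (lebesgue_on {p1..p2})"
    by (intro measurable_restrict_space1 measurable_completion) simp
qed (use continuous_imp_measurable_on_sets_lebesgue[OF cont_v] in simp)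

lemma integrable_wv: "(\<lambda>p. w p *\<^sub>R v p) absolutely_integrable_on {p1..p2}"
proof (rule measurable_bounded_by_integrable_imp_absolutely_integrable[OF measurable_wv])
  show "(\<lambda>p. M * w p) integrable_on {p1..p2}"
    using has_integral_w[of p2] p12 by (auto intro!: integrable_on_mult_right)
  show "norm (w p *\<^sub>R v p) \<le> M * w p" if "p \<in> {p1..p2}" for p
    using bound_v[OF that] w_nonneg[of p] by (simp add: mult.commute mult_right_mono)
qed auto

text \<open>Serves both the oscillating factor \<open>E t x\<close> and the complex Gaussian of
  \<open>gauss_avg\<close>.\<close>

lemma integrable_wv_times:
  assumes cont: "continuous_on {p1..p2} g"
  shows "(\<lambda>p. w p *\<^sub>R v p * g p) absolutely_integrable_on {p1..p2}"
proof -
  have "bounded (g ` {p1..p2})"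
    using cont by (intro compact_imp_bounded compact_continuous_image) auto
  then obtain B where B: "\<forall>p\<in>{p1..p2}. norm (g p) \<le> B"
    unfolding bounded_iff by auto
  show ?thesis
  proof (rule measurable_bounded_by_integrable_imp_absolutely_integrable)
    show "(\<lambda>p. w p *\<^sub>R v p * g p) \<in> borel_measurable (lebesgue_on {p1..p2})"
      by (intro borel_measurable_times measurable_wv
            continuous_imp_measurable_on_sets_lebesgue[OF cont]) auto
    show "(\<lambda>p. norm (w p *\<^sub>R v p) * B) integrable_on {p1..p2}"
      using integrable_wv by (auto simp: absolutely_integrable_on_def intro!: integrable_on_mult_left)
    fix p assume "p \<in> {p1..p2}"
    then show "norm (w p *\<^sub>R v p * g p) \<le> norm (w p *\<^sub>R v p) * B"
      unfolding norm_mult[of "w p *\<^sub>R v p"] using B by (intro mult_left_mono) auto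
  qed auto
qed

lemma integrable_wvE: "(\<lambda>p. w p *\<^sub>R v p * E t x p) integrable_on {p1..p2}"
  using integrable_wv_times[OF continuous_on_E] by (auto simp: absolutely_integrable_on_def)

section \<open>The upper bound, uniform in \<open>x\<close>\<close>

text \<open>At distance at least \<open>d\<close> from both \<open>p1\<close> and \<open>c\<close>,
  the weight is at most \<open>d powr (\<mu> - 1)\<close> and the reciprocal of the phase derivative
  at most \<open>1 / (2 * t * d) = d / 2\<close>. Their product is the factor
  \<open>d powr \<mu> / 2\<close>.\<close>

lemma norm_integral_off_stationary_le:
  assumes d: "d > 0" and t: "t = 1 / d ^ 2" and l: "p1 + d \<le> l" "l \<le> r" "r \<le> p2"
    and c: "c = x / (2 * t)" "r \<le> c - d \<or> c + d \<le> l"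
  shows "norm (integral {l..r} (\<lambda>p. w p *\<^sub>R v p * E t x p)) \<le> d powr \<mu> / 2 * (4 * M + L)"
proof -
  have t0: "t > 0" using d t by simp
  define v' where "v' p = vector_derivative v (at p)" for p
  define k where "k p = 1 / (2 * t * p - x)" for p
  have kd: "k p = 1 / (2 * t * (p - c))" for p
    using c(1) t0 by (simp add: k_def field_simps)
  have k_pos: "0 < k p" if "p \<in> {l..r}" "c + d \<le> l" for p
    using that d t0 by (simp add: kd)
  have k_neg: "k p < 0" if "p \<in> {l..r}" "r \<le> c - d" for p
    using that d t0 by (simp add: kd mult_pos_neg)
  have ne: "2 * t * p - x \<noteq> 0" if "p \<in> {l..r}" for p
    using k_pos[OF that] k_neg[OF that] c(2) by (auto simp: k_def)
  have k_le: "\<bar>k p\<bar> \<le> d / 2" if p: "p \<in> {l..r}" for p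
  proof -
    have "d \<le> \<bar>p - c\<bar>" using c(2) p by auto
    then have "1 / (2 * t * \<bar>p - c\<bar>) \<le> 1 / (2 * t * d)"
      using d t0 by (intro divide_left_mono mult_left_mono mult_pos_pos) auto
    also have "\<dots> = d / 2" using d by (simp add: t power2_eq_square)
    finally show ?thesis using t0 by (simp add: kd abs_mult)
  qed
  have sub: "{l..r} \<subseteq> {p1..p2}" "{l<..<r} \<subseteq> {p1<..<p2}" using l d by auto
  have w_le: "w p \<le> d powr (\<mu> - 1)" if "p \<in> {l..r}" for p
    using that l d \<mu> by (auto simp: w_def intro: powr_mono2')
  have v'_abs: "(\<lambda>p. norm (v' p)) integrable_on {p1<..<p2}"
    using int_v' by (auto simp: v'_def absolutely_integrable_on_def)
  then have v'_int: "(\<lambda>p. norm (v' p)) integrable_on {l<..<r}"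
    using set_integrable_subset[OF int_v' _ sub(2)]
    by (auto simp: v'_def absolutely_integrable_on_def)
  have "norm (integral {l..r} (\<lambda>p. w p *\<^sub>R v p * E t x p))
          \<le> d powr (\<mu> - 1) * (d / 2) * (4 * M + integral {l..r} (\<lambda>p. norm (v' p)))"
  proof (rule oscillatory_integral_by_parts[where k = k and v' = v' and k' = "\<lambda>p. - 2 * t / (2 * t * p - x)\<^sup>2"
        and w' = "\<lambda>p. (\<mu> - 1) * (p - p1) powr (\<mu> - 2)" and E' = "\<lambda>p. \<i> * of_real (x - 2 * t * p) * E t x p"])
    show "l \<le> r" by fact
    show "continuous_on {l..r} w"
      unfolding w_def[abs_def] using l d by (intro continuous_intros) auto
    show "continuous_on {l..r} k"
      unfolding k_def[abs_def] using ne by (intro continuous_intros) auto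
    show "continuous_on {l..r} v" using cont_v sub(1) by (rule continuous_on_subset)
    show "continuous_on {l..r} (E t x)" by (rule continuous_on_E)
    show "(\<lambda>p. norm (v' p)) integrable_on {l..r}"
      using v'_int by (simp add: integrable_on_Icc_iff_Ioo)
    \<comment> \<open>Since the interval lies on one side of \<open>c\<close>, \<open>k\<close>
      keeps its sign, and the difference of two values is no larger than a single bound for their
      absolute values.\<close>
    show "k l - k r \<le> d / 2"
      using c(2) k_pos[of r] k_pos[of l] k_neg[of l] k_neg[of r] k_le[of l] k_le[of r] l by auto
    fix p assume p: "p \<in> {l<..<r}"
    then have p': "p \<in> {l..r}" by auto
    show "(E t x has_vector_derivative \<i> * of_real (x - 2 * t * p) * E t x p) (at p)"
      by (rule has_vector_derivative_E)
    show "(v has_vector_derivative v' p) (at p)"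
      using diff_v[of p] sub p by (auto simp: v'_def vector_derivative_works)
    show "(w has_vector_derivative (\<mu> - 1) * (p - p1) powr (\<mu> - 2)) (at p)"
      unfolding w_def[abs_def] has_real_derivative_iff_has_vector_derivative[symmetric]
      using p l d by (auto intro!: derivative_eq_intros)
    show "(k has_vector_derivative - 2 * t / (2 * t * p - x)\<^sup>2) (at p)"
      unfolding k_def[abs_def] has_real_derivative_iff_has_vector_derivative[symmetric]
      using ne[OF p'] by (auto intro!: derivative_eq_intros simp: power2_eq_square)
    have "k p * (x - 2 * t * p) = -1"
      using ne[OF p'] by (simp add: k_def field_simps)
    then have "complex_of_real (k p) * of_real (x - 2 * t * p) = -1"
      by (metis of_real_mult of_real_minus of_real_1)
    then show "k p *\<^sub>R (\<i> * of_real (x - 2 * t * p) * E t x p) = - (\<i> * E t x p)"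
      unfolding scaleR_conv_of_real by (simp only: mult.assoc mult.left_commute[of _ \<i>]) (simp flip: mult.assoc)
    show "(\<mu> - 1) * (p - p1) powr (\<mu> - 2) \<le> 0" using \<mu> by (simp add: mult_nonpos_nonneg)
    show "- 2 * t / (2 * t * p - x)\<^sup>2 \<le> 0" using t0 by simp
  qed (use sub(1) bound_v w_nonneg w_le k_le in auto)
  also have "d powr (\<mu> - 1) * (d / 2) = d powr \<mu> / 2"
    using d by (simp add: powr_diff)
  also have "integral {l..r} (\<lambda>p. norm (v' p)) \<le> L"
    unfolding L_def integral_open_interval_real v'_def[symmetric]
    using v'_int v'_abs sub by (intro integral_subset_le) auto
  finally show ?thesis using d by (simp add: mult_left_mono)
qed

lemma norm_integral_wvE_le:
  assumes t: "0 < t"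
  shows "norm (integral {p1..p2} (\<lambda>p. w p *\<^sub>R v p * E t x p)) \<le> t powr (- \<mu> / 2) * (5 * M / \<mu> + 4 * M + L)"
proof -
  define F where "F p = w p *\<^sub>R v p * E t x p" for p
  define d where "d = t powr (- 1 / 2)"
  have d: "0 < d" using t by (simp add: d_def)
  have td: "t = 1 / d ^ 2" using t by (simp add: d_def powr_power powr_minus field_simps)
  have d_powr: "d powr \<mu> = t powr (- \<mu> / 2)" by (simp add: d_def powr_powr)
  define c where "c = x / (2 * t)"
  \<comment> \<open>The cut points are clamped to stay ordered inside the interval wherever
    \<open>c\<close> lies. A nondegenerate \<open>{a..b}\<close> lies left of \<open>c - d\<close>,
    \<open>{b..e}\<close> lies within \<open>d\<close> of \<open>c\<close>, and a nondegenerate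
    \<open>{e..p2}\<close> lies right of \<open>c + d\<close>.\<close>
  define a where "a = min (p1 + d) p2"
  define b where "b = max a (min p2 (c - d))"
  define e where "e = max b (min p2 (c + d))"
  have ord: "p1 \<le> a" "a \<le> b" "b \<le> e" "e \<le> p2"
    using p12 d by (auto simp: a_def b_def e_def)
  have F_int: "F integrable_on {l..r}" if "p1 \<le> l" "r \<le> p2" for l r
    unfolding F_def by (rule integrable_subinterval_real[OF integrable_wvE]) (use that in auto)
  have F_le: "norm (F p) \<le> M * w p" if "p \<in> {p1..p2}" for p
    using bound_v[OF that] w_nonneg[of p] by (simp add: F_def norm_mult mult.commute mult_right_mono)
  have L0: "0 \<le> L" unfolding L_def by (intro integral_nonneg) (use int_v' in \<open>auto simp: absolutely_integrable_on_def\<close>)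
  have V0: "0 \<le> d powr \<mu> / 2 * (4 * M + L)" using M_nonneg L0 by simp
  have "integral {p1..p2} F = integral {p1..a} F + integral {a..b} F + integral {b..e} F + integral {e..p2} F"
    using ord by (simp add: Henstock_Kurzweil_Integration.integral_combine F_int)
  then have "norm (integral {p1..p2} F)
    \<le> norm (integral {p1..a} F) + norm (integral {a..b} F) + norm (integral {b..e} F) + norm (integral {e..p2} F)"
    by (simp add: norm_triangle_le norm_triangle_mono)
  moreover have "norm (integral {p1..a} F) \<le> M * d powr \<mu> / \<mu>"
  proof -
    have "norm (integral {p1..a} F) \<le> integral {p1..a} (\<lambda>p. M * w p)"
      using F_int[of p1 a] has_integral_w[OF ord(1)] ord F_le
      by (intro integral_norm_bound_integral) (auto intro!: integrable_on_mult_right)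
    also have "\<dots> = M * ((a - p1) powr \<mu> / \<mu>)"
      using has_integral_w[OF ord(1)] by (simp add: integral_unique)
    also have "\<dots> \<le> M * (d powr \<mu> / \<mu>)"
      using ord(1) \<mu> M_nonneg by (intro mult_left_mono divide_right_mono powr_mono2) (auto simp: a_def)
    finally show ?thesis by simp
  qed
  moreover have "norm (integral {a..b} F) \<le> d powr \<mu> / 2 * (4 * M + L)"
  proof (cases "a < b")
    case True
    then show ?thesis unfolding F_def
      using ord by (intro norm_integral_off_stationary_le[OF d td _ _ _ c_def]) (auto simp: a_def b_def)
  qed (use V0 ord in auto)
  moreover have "norm (integral {e..p2} F) \<le> d powr \<mu> / 2 * (4 * M + L)"
  proof (cases "e < p2")
    case True
    then show ?thesis unfolding F_def
      using ord by (intro norm_integral_off_stationary_le[OF d td _ _ _ c_def]) (auto simp: a_def b_def e_def)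
  qed (use V0 ord in auto)
  moreover have "norm (integral {b..e} F) \<le> 2 * M * d powr \<mu>"
  proof (cases "b < e")
    case True
    \<comment> \<open>A nonempty window forces \<open>b < p2\<close>, which excludes both
      \<open>a = p2\<close> and truncation of \<open>c - d\<close> at \<open>p2\<close>.\<close>
    then have "e = min p2 (c + d)" unfolding e_def by linarith
    then have "e \<le> c + d" "b < p2" using True by linarith+
    moreover have "a \<le> b" "min p2 (c - d) \<le> b" unfolding b_def by linarith+
    ultimately have be: "e - b \<le> 2 * d" "p1 + d \<le> b" unfolding a_def by linarith+
    have F_le': "norm (F p) \<le> M * d powr (\<mu> - 1)" if "p \<in> {b..e}" for p
    proof -
      have "w p \<le> d powr (\<mu> - 1)"
        unfolding w_def using that be d \<mu> by (intro powr_mono2') auto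
      then have "M * w p \<le> M * d powr (\<mu> - 1)" using M_nonneg by (intro mult_left_mono)
      then show ?thesis using F_le[of p] that ord by auto
    qed
    have "norm (integral {b..e} F) \<le> integral {b..e} (\<lambda>p. M * d powr (\<mu> - 1))"
      using F_int[of b e] ord F_le' by (intro integral_norm_bound_integral) auto
    also have "\<dots> = M * d powr (\<mu> - 1) * (e - b)" using ord by simp
    also have "\<dots> \<le> M * d powr (\<mu> - 1) * (2 * d)"
      using be M_nonneg by (intro mult_left_mono) auto
    also have "\<dots> = 2 * M * d powr \<mu>"
      using d by (simp add: powr_diff)
    finally show ?thesis .
  qed (use ord M_nonneg in auto)
  \<comment> \<open>\<open>M / \<mu>\<close> comes from the singularity, \<open>2 * M\<close> from
    the stationary window and \<open>4 * M + L\<close> from the two outer intervals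
    together.\<close>
  ultimately have "norm (integral {p1..p2} F) \<le> d powr \<mu> * (M / \<mu> + 6 * M + L)"
    by (simp add: algebra_simps)
  also have "\<dots> \<le> d powr \<mu> * (5 * M / \<mu> + 4 * M + L)"
  proof -
    have "M \<le> M / \<mu>" using \<mu> M_nonneg by (simp add: pos_le_divide_eq mult_left_le)
    moreover have "5 * M / \<mu> = 5 * (M / \<mu>)" by simp
    moreover note M_nonneg
    ultimately have "M / \<mu> + 6 * M + L \<le> 5 * M / \<mu> + 4 * M + L" by linarith
    then show ?thesis by (intro mult_left_mono) auto
  qed
  finally show ?thesis unfolding F_def[abs_def] d_powr .
qed

section \<open>Gaussian integrals concentrated near a point \<open>q\<close>\<close>

definition gauss :: "real \<Rightarrow> real \<Rightarrow> real \<Rightarrow> real"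
  where "gauss q t p = exp (- (t * (p - q)\<^sup>2))"

text \<open>The name anticipates \<open>norm_gauss_avg_le\<close>. The exponential has modulus
  \<open>gauss q t p\<close>, so for large \<open>t\<close> the integral localizes at
  \<open>q\<close>.\<close>

definition gauss_avg where
  "gauss_avg q t = integral {p1..p2} (\<lambda>p. w p *\<^sub>R v p * exp (- ((1 + \<i>) * of_real (t * (p - q)\<^sup>2))))"

lemma exp_one_plus_ii: "exp (- ((1 + \<i>) * of_real (t * (p - q)\<^sup>2)))
    = of_real (gauss q t p) * exp (\<i> * of_real (- (t * (p - q)\<^sup>2)))"
  unfolding gauss_def exp_of_real[symmetric] exp_add[symmetric] by (simp add: algebra_simps)

lemma gauss_pos: "0 < gauss q t p"
  by (simp add: gauss_def)

lemma integrable_w_sub: "p1 \<le> l \<Longrightarrow> r \<le> p2 \<Longrightarrow> w integrable_on {l..r}"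
  by (rule integrable_subinterval_real[of w p1 p2]) (use has_integral_w[of p2] p12 in auto)

lemma integrable_w_times:
  fixes f :: "real \<Rightarrow> real"
  assumes "continuous_on {l..r} f" "p1 \<le> l" "r \<le> p2"
  shows "(\<lambda>p. w p * f p) integrable_on {l..r}"
proof -
  have "w absolutely_integrable_on {l..r}"
    using integrable_w_sub[OF assms(2,3)] w_nonneg by (intro nonnegative_absolutely_integrable_1) auto
  moreover have "compact (f ` {l..r})" by (intro compact_continuous_image assms) auto
  ultimately have "(\<lambda>p. f p * w p) absolutely_integrable_on {l..r}"
    using assms(1)
    by (intro absolutely_integrable_bounded_measurable_product_real
          continuous_imp_measurable_on_sets_lebesgue compact_imp_bounded) auto
  then show ?thesis by (simp add: absolutely_integrable_on_def mult.commute)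
qed

lemma integrable_gauss_avg:
  assumes "p1 \<le> l" "r \<le> p2"
  shows "(\<lambda>p. w p *\<^sub>R v p * exp (- ((1 + \<i>) * of_real (t * (p - q)\<^sup>2)))) integrable_on {l..r}"
proof (rule integrable_subinterval_real)
  show "(\<lambda>p. w p *\<^sub>R v p * exp (- ((1 + \<i>) * of_real (t * (p - q)\<^sup>2)))) integrable_on {p1..p2}"
    by (intro absolutely_integrable_on_def[THEN iffD1, THEN conjunct1] integrable_wv_times continuous_intros)
qed (use assms in auto)

text \<open>Follows from \<open>((p - q) w g)' = (\<mu> - 2 t (p - q)\<^sup>2) w g\<close> for \<open>g = gauss q t\<close>.\<close>
lemma integral_gauss_second_moment:
  assumes lr: "p1 \<le> l" "l \<le> q" "q \<le> r" "r \<le> p2"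
    and q: "q = p1 \<or> \<mu> = 1 \<and> p1 < l"
  shows "integral {l..r} (\<lambda>p. w p * (gauss q t p * (t * (p - q)\<^sup>2)))
       \<le> integral {l..r} (\<lambda>p. w p * gauss q t p) / 2"
proof -
  let ?K = "integral {l..r} (\<lambda>p. w p * gauss q t p)"
  let ?J = "integral {l..r} (\<lambda>p. w p * (gauss q t p * (t * (p - q)\<^sup>2)))"
  have lr': "l \<le> r" using lr by simp
  define G where "G p = (p - q) * w p * gauss q t p" for p
  have "((\<lambda>p. \<mu> * (w p * gauss q t p) - 2 * (w p * (gauss q t p * (t * (p - q)\<^sup>2)))) has_integral (G r - G l)) {l..r}"
  proof (rule fundamental_theorem_of_calculus_interior[OF lr'])
    \<comment> \<open>For \<open>q = p1\<close> the factor \<open>p - p1\<close> turns the singular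
      weight into \<open>(p - p1) powr \<mu>\<close>, continuous up to \<open>p1\<close>; for
      \<open>\<mu> = 1\<close> the weight is constant on \<open>{l..r}\<close>.\<close>
    have "continuous_on {l..r} (\<lambda>p. (p - q) * w p)"
      using q
    proof
      assume q: "q = p1"
      have "continuous_on {l..r} (\<lambda>p. (p - p1) powr \<mu>)"
        using lr \<mu> by (intro continuous_on_powr' continuous_intros) auto
      moreover have "(p - p1) powr \<mu> = (p - p1) * w p" if "p \<in> {l..r}" for p
        using that lr q by (cases "p = p1") (auto simp: w_def powr_diff)
      ultimately show ?thesis
        unfolding q by (subst (asm) continuous_on_cong[OF refl]) auto
    next
      assume "\<mu> = 1 \<and> p1 < l"
      then show ?thesis
        unfolding w_def using lr by (intro continuous_intros) auto
    qed
    moreover have "continuous_on {l..r} (gauss q t)"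
      unfolding gauss_def by (intro continuous_intros)
    ultimately show "continuous_on {l..r} G"
      unfolding G_def by (rule continuous_on_mult)
    fix p assume p: "p \<in> {l<..<r}"
    have pp: "p1 < p" using p lr by auto
    \<comment> \<open>For \<open>q = p1\<close> this is homogeneity of the power; for
      \<open>\<mu> = 1\<close> both sides vanish.\<close>
    have eq: "(p - q) * ((\<mu> - 1) * (p - p1) powr (\<mu> - 2)) = (\<mu> - 1) * w p"
      using q pp by (auto simp: w_def powr_diff power2_eq_square)
    have w': "(w has_real_derivative (\<mu> - 1) * (p - p1) powr (\<mu> - 2)) (at p)"
      unfolding w_def[abs_def] using pp by (auto intro!: derivative_eq_intros)
    have g': "(gauss q t has_real_derivative (- (2 * t * (p - q)) * gauss q t p)) (at p)"
      unfolding gauss_def[abs_def] by (auto intro!: derivative_eq_intros)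
    have "(G has_real_derivative (w p + (p - q) * ((\<mu> - 1) * (p - p1) powr (\<mu> - 2))) * gauss q t p
             + (p - q) * w p * (- (2 * t * (p - q)) * gauss q t p)) (at p)"
      unfolding G_def[abs_def] by (auto intro!: derivative_eq_intros w' g')
    then have "(G has_real_derivative (\<mu> * (w p * gauss q t p) - 2 * (w p * (gauss q t p * (t * (p - q)\<^sup>2))))) (at p)"
      unfolding eq by (rule DERIV_cong) (simp add: algebra_simps power2_eq_square)
    then show "(G has_vector_derivative (\<mu> * (w p * gauss q t p) - 2 * (w p * (gauss q t p * (t * (p - q)\<^sup>2))))) (at p)"
      by (simp add: has_real_derivative_iff_has_vector_derivative)
  qed
  moreover have "((\<lambda>p. \<mu> * (w p * gauss q t p) - 2 * (w p * (gauss q t p * (t * (p - q)\<^sup>2)))) has_integral (\<mu> * ?K - 2 * ?J)) {l..r}"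
    unfolding gauss_def
    by (intro has_integral_diff has_integral_mult_right integrable_integral
        integrable_w_times continuous_intros lr)
  ultimately have "\<mu> * ?K - 2 * ?J = G r - G l"
    by (rule has_integral_unique[rotated])
  \<comment> \<open>The boundary terms have favourable signs because
    \<open>l \<le> q \<le> r\<close>; hence \<open>2 * ?J \<le> \<mu> * ?K \<le> ?K\<close>.\<close>
  moreover have "G l \<le> 0" "0 \<le> G r"
    using lr w_nonneg gauss_pos[of q t l] gauss_pos[of q t r]
    by (auto simp: G_def mult_nonpos_nonneg less_imp_le)
  moreover have "0 \<le> ?K"
    by (intro integral_nonneg integrable_w_times lr mult_nonneg_nonneg w_nonneg
          less_imp_le[OF gauss_pos]) (auto simp: gauss_def intro!: continuous_intros)
  moreover have "\<mu> * ?K \<le> 1 * ?K" by (intro mult_right_mono \<mu> calculation)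
  ultimately show ?thesis by linarith
qed

text \<open>On an interval of length \<open>d = t powr (- 1 / 2)\<close> to the right of
  \<open>q\<close>, the Gaussian is at least \<open>exp (-1)\<close> since
  \<open>t * d\<^sup>2 = 1\<close>, and the weight at least
  \<open>d powr (\<mu> - 1)\<close>.\<close>

lemma integral_gauss_mass:
  assumes t: "0 < t" and q: "p1 \<le> l" "l \<le> q" "q + t powr (- 1 / 2) \<le> r" "r \<le> p2" "q = p1 \<or> \<mu> = 1"
  shows "exp (-1) * t powr (- \<mu> / 2) \<le> integral {l..r} (\<lambda>p. w p * gauss q t p)"
proof -
  define d where "d = t powr (- 1 / 2)"
  have d: "0 < d" using t by (simp add: d_def)
  have d2: "t * d\<^sup>2 = 1" using t by (simp add: d_def powr_power powr_minus field_simps)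
  have int: "(\<lambda>p. w p * gauss q t p) integrable_on {l..r}"
    unfolding gauss_def by (intro integrable_w_times continuous_intros q)
  have sub: "{q<..<q+d} \<subseteq> {l..r}" using q by (auto simp: d_def)
  have int': "(\<lambda>p. w p * gauss q t p) integrable_on {q<..<q+d}"
    unfolding integrable_on_Icc_iff_Ioo[symmetric]
    by (rule integrable_subinterval_real[OF int]) (use q in \<open>auto simp: d_def\<close>)
  have "exp (-1) * t powr (- \<mu> / 2) = exp (-1) * (d powr (\<mu> - 1) * d)"
    using d by (simp add: powr_diff) (simp add: d_def powr_powr)
  \<comment> \<open>The left end is excluded: if \<open>q = p1\<close>, then \<open>w q = 0\<close>
    because \<open>0 powr a = 0\<close> for every \<open>a\<close>, even
    \<open>a = 0\<close>.\<close>
  also have "\<dots> = integral {q<..<q+d} (\<lambda>p. exp (-1) * d powr (\<mu> - 1))"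
    using d by (simp flip: integral_open_interval_real)
  also have "\<dots> \<le> integral {q<..<q+d} (\<lambda>p. w p * gauss q t p)"
  proof (rule integral_le[OF _ int'])
    show "(\<lambda>p. exp (-1) * d powr (\<mu> - 1)) integrable_on {q<..<q+d}"
      by (subst integrable_on_Icc_iff_Ioo[symmetric]) (rule integrable_const_ivl)
    fix p assume p: "p \<in> {q<..<q+d}"
    have "d powr (\<mu> - 1) \<le> w p"
      using q(5)
    proof
      assume "q = p1"
      then show ?thesis unfolding w_def using p d \<mu> by (intro powr_mono2') auto
    next
      assume "\<mu> = 1"
      then show ?thesis unfolding w_def using p q d by simp
    qed
    moreover have "exp (-1) \<le> gauss q t p"
    proof -
      have "t * (p - q)\<^sup>2 \<le> t * d\<^sup>2"
        using p t by (intro mult_left_mono power_mono) auto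
      then show ?thesis by (simp add: gauss_def d2)
    qed
    ultimately show "exp (-1) * d powr (\<mu> - 1) \<le> w p * gauss q t p"
      by (subst mult.commute) (intro mult_mono w_nonneg, auto)
  qed
  also have "\<dots> \<le> integral {l..r} (\<lambda>p. w p * gauss q t p)"
    using int int' sub w_nonneg gauss_pos by (intro integral_subset_le) (auto simp: less_imp_le)
  finally show ?thesis .
qed

text \<open>Let \<open>K\<close> be the Gaussian mass of a small window around \<open>q\<close>.
  There the integral differs from \<open>K *\<^sub>R v q\<close> by at most a quarter of
  \<open>norm (v q) * K\<close> through continuity of \<open>v\<close>, and by a half through the
  second moment bound on the phase. A quarter survives, while the tails are exponentially small in
  \<open>t\<close>.\<close>

lemma gauss_avg_lower_bound:
  assumes q: "p1 \<le> q" "q < p2" "q = p1 \<or> \<mu> = 1" "v q \<noteq> 0"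
  shows "\<exists>c>0. eventually (\<lambda>t. c \<le> t powr (\<mu> / 2) * norm (gauss_avg q t)) at_top"
proof -
  have "continuous (at q within {p1..p2}) v"
    using cont_v q by (auto simp: continuous_on_eq_continuous_within)
  then obtain e where e: "0 < e" "\<And>p. p \<in> {p1..p2} \<Longrightarrow> \<bar>p - q\<bar> < e \<Longrightarrow> norm (v p - v q) < norm (v q) / 4"
    using q(4) unfolding continuous_within_eps_delta dist_norm real_norm_def
    by (metis zero_less_divide_iff zero_less_norm_iff zero_less_numeral)
  \<comment> \<open>For an interior \<open>q\<close> the window must stay strictly to the right of
    \<open>p1\<close>, as \<open>integral_gauss_second_moment\<close> requires; for
    \<open>q = p1\<close> it is one-sided with \<open>l = p1\<close>.\<close>
  define h where "h = Min ({e / 2, p2 - q} \<union> (if q = p1 then {} else {(q - p1) / 2}))"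
  have h: "0 < h" "h < e" "q + h \<le> p2" "q \<noteq> p1 \<Longrightarrow> p1 < q - h"
    using e(1) q by (auto simp: h_def min_def field_simps)
  define l where "l = max p1 (q - h)"
  define r where "r = q + h"
  have lr: "p1 \<le> l" "l \<le> q" "q \<le> r" "r \<le> p2" "q = p1 \<or> \<mu> = 1 \<and> p1 < l"
    using h q by (auto simp: l_def r_def)
  define W where "W = integral {p1..p2} w"
  \<comment> \<open>\<open>B\<close> collects the two tails, each at most
    \<open>M * W * exp (- (t * h\<^sup>2))\<close>; \<open>k\<close> is the surviving quarter of
    \<open>norm (v q)\<close> times the constant of \<open>integral_gauss_mass\<close>.\<close>
  define B where "B = 2 * M * W"
  define k where "k = norm (v q) / 4 * exp (-1)"
  have k: "0 < k" using q(4) by (simp add: k_def)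
  define F where "F t p = w p *\<^sub>R v p * exp (- ((1 + \<i>) * of_real (t * (p - q)\<^sup>2)))" for t p
  have F_int: "F t integrable_on {a..b}" if "p1 \<le> a" "b \<le> p2" for t a b
    unfolding F_def using that by (rule integrable_gauss_avg)
  have F_eq: "F t p = (w p * gauss q t p) *\<^sub>R (v p * exp (\<i> * of_real (- (t * (p - q)\<^sup>2))))" for t p
    unfolding F_def exp_one_plus_ii by (simp add: scaleR_conv_of_real mult_ac)
  have tail: "norm (integral {a..b} (F t)) \<le> M * exp (- (t * h\<^sup>2)) * W"
    if ab: "p1 \<le> a" "b \<le> p2" "b = l \<or> a = r" "0 < t" for t a b
  proof -
    have le: "norm (F t p) \<le> M * exp (- (t * h\<^sup>2)) * w p" if p: "p \<in> {a<..<b}" for p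
    proof -
      \<comment> \<open>If \<open>l = p1\<close>, an interval ending at \<open>l\<close> has no
        interior points; otherwise \<open>l = q - h\<close>.\<close>
      have "h \<le> \<bar>p - q\<bar>" using p ab by (auto simp: l_def r_def)
      then have "t * h\<^sup>2 \<le> t * (p - q)\<^sup>2"
        using h(1) ab(4) by (intro mult_left_mono) (auto simp: abs_le_square_iff[symmetric])
      then have "gauss q t p \<le> exp (- (t * h\<^sup>2))" by (simp add: gauss_def)
      then have "gauss q t p * norm (v p) \<le> exp (- (t * h\<^sup>2)) * M"
        using p ab by (intro mult_mono bound_v) auto
      from mult_left_mono[OF this w_nonneg[of p]] show ?thesis
        using w_nonneg[of p] gauss_pos[of q t p] by (simp add: F_eq norm_mult abs_mult mult_ac)
    qed
    have w_int: "w integrable_on {a<..<b}"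
      using integrable_w_sub[OF ab(1,2)] by (simp add: integrable_on_Icc_iff_Ioo)
    have "norm (integral {a<..<b} (F t)) \<le> integral {a<..<b} (\<lambda>p. M * exp (- (t * h\<^sup>2)) * w p)"
      using F_int[OF ab(1,2)] w_int le
      by (intro integral_norm_bound_integral integrable_on_mult_right) (auto simp: integrable_on_Icc_iff_Ioo)
    also have "\<dots> = M * exp (- (t * h\<^sup>2)) * integral {a<..<b} w" by simp
    also have "integral {a<..<b} w \<le> W"
      unfolding W_def using w_int integrable_w_sub[of p1 p2] ab w_nonneg
      by (intro integral_subset_le) auto
    finally show ?thesis
      using M_nonneg by (simp add: mult_left_mono flip: integral_open_interval_real)
  qed
  have window: "norm (v q) / 4 * integral {l..r} (\<lambda>p. w p * gauss q t p) \<le> norm (integral {l..r} (F t))"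
    if t: "0 < t" for t
  proof -
    let ?K = "integral {l..r} (\<lambda>p. w p * gauss q t p)"
    let ?J = "integral {l..r} (\<lambda>p. w p * (gauss q t p * (t * (p - q)\<^sup>2)))"
    have K: "((\<lambda>p. w p * gauss q t p) has_integral ?K) {l..r}"
      unfolding gauss_def by (intro integrable_integral integrable_w_times continuous_intros lr)
    have J: "((\<lambda>p. w p * (gauss q t p * (t * (p - q)\<^sup>2))) has_integral ?J) {l..r}"
      unfolding gauss_def by (intro integrable_integral integrable_w_times continuous_intros lr)
    define D where "D p = norm (v q) / 4 * (w p * gauss q t p) + norm (v q) * (w p * (gauss q t p * (t * (p - q)\<^sup>2)))" for p
    have D: "(D has_integral (norm (v q) / 4 * ?K + norm (v q) * ?J)) {l..r}"
      unfolding D_def by (intro has_integral_add has_integral_mult_right K J)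
    have FK: "((\<lambda>p. F t p - (w p * gauss q t p) *\<^sub>R v q) has_integral (integral {l..r} (F t) - ?K *\<^sub>R v q)) {l..r}"
      by (intro has_integral_diff integrable_integral F_int lr has_integral_scaleR_left K)
    have "norm (integral {l..r} (F t) - ?K *\<^sub>R v q) \<le> norm (v q) / 4 * ?K + norm (v q) * ?J"
    proof (rule integral_norm_bound_integral[OF has_integral_integrable[OF FK] has_integral_integrable[OF D],
             unfolded integral_unique[OF FK] integral_unique[OF D]])
      fix p assume p: "p \<in> {l..r}"
      let ?x = "exp (\<i> * complex_of_real (- (t * (p - q)\<^sup>2)))"
      have "norm (v p * ?x - v q) = norm ((v p - v q) * ?x + v q * (?x - 1))"
        by (simp add: algebra_simps)
      also have "\<dots> \<le> norm (v p - v q) * 1 + norm (v q) * norm (?x - 1)"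
        by (rule order_trans[OF norm_triangle_ineq]) (simp only: norm_mult norm_exp_i_times order_refl)
      also have "\<dots> \<le> norm (v q) / 4 * 1 + norm (v q) * (t * (p - q)\<^sup>2)"
      proof (intro add_mono mult_mono)
        have "p \<in> {p1..p2}" "\<bar>p - q\<bar> < e"
          using p lr h by (auto simp: l_def r_def)
        then show "norm (v p - v q) \<le> norm (v q) / 4" using e(2) by (simp add: less_imp_le)
        show "norm (?x - 1) \<le> t * (p - q)\<^sup>2"
          using norm_exp_ii_minus_one_le[of "- (t * (p - q)\<^sup>2)"] t by simp
      qed auto
      finally have "(w p * gauss q t p) * norm (v p * ?x - v q)
          \<le> (w p * gauss q t p) * (norm (v q) / 4 * 1 + norm (v q) * (t * (p - q)\<^sup>2))"
        using w_nonneg gauss_pos by (intro mult_left_mono) (auto simp: less_imp_le)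
      also have "\<dots> = D p" by (simp add: D_def algebra_simps)
      finally show "norm (F t p - (w p * gauss q t p) *\<^sub>R v q) \<le> D p"
        unfolding F_eq scaleR_diff_right[symmetric] norm_scaleR
        using w_nonneg[of p] gauss_pos[of q t p] by (simp add: abs_mult)
    qed
    also have "\<dots> \<le> norm (v q) / 4 * ?K + norm (v q) * (?K / 2)"
      using integral_gauss_second_moment[OF lr] by (intro add_left_mono mult_left_mono) auto
    finally have "norm (?K *\<^sub>R v q - integral {l..r} (F t)) \<le> norm (v q) * ?K * (3 / 4)"
      by (simp add: norm_minus_commute)
    moreover have "norm (?K *\<^sub>R v q) = norm (v q) * ?K"
    proof -
      have "0 \<le> ?K" using w_nonneg gauss_pos by (intro integral_nonneg has_integral_integrable[OF K]) (auto simp: less_imp_le)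
      then show ?thesis by (simp add: mult.commute)
    qed
    ultimately show ?thesis
      using norm_triangle_ineq2[of "?K *\<^sub>R v q" "integral {l..r} (F t)"] by linarith
  qed
  have lower: "k - B * (t powr (\<mu> / 2) * exp (- (t * h\<^sup>2))) \<le> t powr (\<mu> / 2) * norm (gauss_avg q t)"
    if t: "0 < t" "t powr (- 1 / 2) < h" for t
  proof -
    have "gauss_avg q t = integral {p1..l} (F t) + integral {l..r} (F t) + integral {r..p2} (F t)"
      using lr unfolding gauss_avg_def F_def[symmetric]
      by (simp add: Henstock_Kurzweil_Integration.integral_combine F_int)
    moreover have "norm b \<le> norm (a + b + c) + norm a + norm c" for a b c :: complex
    proof -
      have "norm (a + b + c - a - c) \<le> norm (a + b + c) + norm a + norm c"
        by (intro order_trans[OF norm_triangle_ineq4] add_right_mono norm_triangle_ineq4)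
      then show ?thesis by simp
    qed
    ultimately have "norm (integral {l..r} (F t)) \<le> norm (gauss_avg q t) + norm (integral {p1..l} (F t)) + norm (integral {r..p2} (F t))"
      by metis
    moreover have "norm (integral {p1..l} (F t)) \<le> M * exp (- (t * h\<^sup>2)) * W"
        "norm (integral {r..p2} (F t)) \<le> M * exp (- (t * h\<^sup>2)) * W"
      using lr t by (intro tail; simp)+
    moreover have "k * t powr (- \<mu> / 2) \<le> norm (integral {l..r} (F t))"
    proof -
      have "exp (-1) * t powr (- \<mu> / 2) \<le> integral {l..r} (\<lambda>p. w p * gauss q t p)"
        using lr t by (intro integral_gauss_mass) (auto simp: r_def)
      from mult_left_mono[OF this, of "norm (v q) / 4"] window[OF t(1)] show ?thesis
        by (simp add: k_def mult_ac)
    qed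
    ultimately have "k * t powr (- \<mu> / 2) - B * exp (- (t * h\<^sup>2)) \<le> norm (gauss_avg q t)"
      by (simp add: B_def mult_ac)
    from mult_left_mono[OF this, of "t powr (\<mu> / 2)"] show ?thesis
      using t by (simp add: right_diff_distrib mult_ac powr_minus)
  qed
  have "((\<lambda>t. t powr (\<mu> / 2) * exp (- (t * h\<^sup>2))) \<longlongrightarrow> 0) at_top"
    using h(1) by real_asymp
  then have "((\<lambda>t. k - B * (t powr (\<mu> / 2) * exp (- (t * h\<^sup>2)))) \<longlongrightarrow> k - B * 0) at_top"
    by (intro tendsto_intros)
  then have "eventually (\<lambda>t. k / 2 < k - B * (t powr (\<mu> / 2) * exp (- (t * h\<^sup>2)))) at_top"
    using k by (intro order_tendstoD) auto
  moreover have "((\<lambda>t::real. t powr (- 1 / 2)) \<longlongrightarrow> 0) at_top"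
    by real_asymp
  then have "eventually (\<lambda>t. t powr (- 1 / 2) < h) at_top"
    using h(1) by (rule order_tendstoD)
  ultimately have "eventually (\<lambda>t. k / 2 \<le> t powr (\<mu> / 2) * norm (gauss_avg q t)) at_top"
    using eventually_gt_at_top[of 0] by eventually_elim (use lower in force)
  then show ?thesis using k by (intro exI[of _ "k / 2"]) auto
qed

section \<open>Comparison of the oscillatory and Gaussian integrals\<close>

text \<open>Extension by zero gives a Borel function on the line, as needed for Fubini on the
  product of the normal distribution and \<open>lborel\<close>.\<close>

definition amp where "amp p = indicator {p1..p2} p *\<^sub>R (w p *\<^sub>R v p)"
definition osc where "osc t x = integral {p1..p2} (\<lambda>p. w p *\<^sub>R v p * E t x p)"

lemma measurable_amp [measurable]: "amp \<in> borel_measurable borel"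
proof -
  have "(\<lambda>p. indicator {p1..p2} p *\<^sub>R v p) \<in> borel_measurable borel"
    by (intro borel_measurable_continuous_on_indicator cont_v) auto
  from borel_measurable_scaleR[OF measurable_w this] show ?thesis
    by (simp add: amp_def[abs_def] mult.commute)
qed

lemma integrable_amp: "integrable lborel amp"
  using integrable_wv unfolding set_integrable_def amp_def[abs_def, symmetric]
  by (subst (asm) integrable_completion) auto

text \<open>The bridge from the gauge integral on the interval, suited to integration by parts, to
  the Lebesgue integral on the line, suited to dominated convergence and Fubini.\<close>

lemma integral_amp:
  assumes g: "continuous_on UNIV g"
  shows "integral {p1..p2} (\<lambda>p. w p *\<^sub>R v p * g p) = (LINT p|lborel. amp p * g p)"
proof -
  have [measurable]: "g \<in> borel_measurable borel"
    using g by (rule borel_measurable_continuous_onI)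
  have "integral {p1..p2} (\<lambda>p. w p *\<^sub>R v p * g p) = (LINT p:{p1..p2}|lebesgue. w p *\<^sub>R v p * g p)"
    using continuous_on_subset[OF g]
    by (intro set_lebesgue_integral_eq_integral(2)[symmetric] integrable_wv_times) auto
  also have "\<dots> = (LINT p|lebesgue. amp p * g p)"
    by (simp add: set_lebesgue_integral_def amp_def)
  also have "\<dots> = (LINT p|lborel. amp p * g p)"
    by (rule integral_completion) measurable
  finally show ?thesis .
qed

lemma osc_eq: "osc t x = (LINT p|lborel. amp p * E t x p)"
  unfolding osc_def by (rule integral_amp[OF continuous_on_E])

lemma measurable_E [measurable]: "E t x \<in> borel_measurable borel"
  by (rule borel_measurable_continuous_onI[OF continuous_on_E])

text \<open>Dominated convergence with majorant \<open>norm (amp p)\<close>. Continuity in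
  \<open>x\<close> is what lets the essential supremum control every value.\<close>

lemma continuous_on_osc: "continuous_on UNIV (osc t)"
  unfolding continuous_on_sequentially o_def
proof safe
  fix X :: "nat \<Rightarrow> real" and x assume X: "X \<longlonglongrightarrow> x"
  show "(\<lambda>n. osc t (X n)) \<longlonglongrightarrow> osc t x"
    unfolding osc_eq
  proof (rule integral_dominated_convergence[where w = "\<lambda>p. norm (amp p)"])
    show "integrable lborel (\<lambda>p. norm (amp p))" using integrable_amp by simp
    show "AE p in lborel. (\<lambda>n. amp p * E t (X n) p) \<longlonglongrightarrow> amp p * E t x p"
      unfolding E_def by (intro AE_I2 tendsto_intros X)
  qed (auto simp: norm_mult)
qed

text \<open>Averages \<open>osc t (2 t q + \<surd>(2 t) z)\<close>, up to a unimodular factor, over a standard normal \<open>z\<close>.\<close>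
lemma norm_gauss_avg_le:
  assumes t: "0 < t" and C: "\<And>x. norm (osc t x) \<le> C"
  shows "norm (gauss_avg q t) \<le> C"
proof -
  let ?N = std_normal_distribution
  interpret N: real_distribution ?N by (rule real_dist_normal_dist)
  interpret P: pair_sigma_finite ?N lborel ..
  \<comment> \<open>With this scale the standard normal characteristic function at
    \<open>s * (p - q)\<close> is exactly \<open>gauss q t p\<close>.\<close>
  define s where "s = sqrt (2 * t)"
  have s2: "s\<^sup>2 = 2 * t" using t by (simp add: s_def)
  define f where "f z p = amp p * (iexp (- (t * (p - q)\<^sup>2)) * iexp (s * (p - q) * z))" for z p
  have norm_f: "norm (f z p) = norm (amp p)" for z p
    by (simp only: f_def norm_mult norm_exp_i_times mult_1_right)
  have [measurable]: "case_prod f \<in> borel_measurable (?N \<Otimes>\<^sub>M lborel)"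
    unfolding f_def by measurable
  have f_int2: "integrable lborel (f z)" for z
  proof (rule Bochner_Integration.integrable_bound[OF integrable_amp])
    show "f z \<in> borel_measurable lborel" unfolding f_def by measurable
  qed (simp add: norm_f)
  have f_int: "integrable (?N \<Otimes>\<^sub>M lborel) (case_prod f)"
    by (rule P.Fubini_integrable) (simp_all add: norm_f f_int2)
  \<comment> \<open>Expanding the square in the phase of \<open>f\<close> separates a constant from
    \<open>(2 * t * q + s * z) * p - t * p\<^sup>2\<close>, the phase of \<open>E\<close>.\<close>
  have "integral\<^sup>L lborel (f z) = iexp (- (t * q\<^sup>2 + s * z * q)) * osc t (2 * t * q + s * z)" for z
  proof -
    have eq: "f z = (\<lambda>p. iexp (- (t * q\<^sup>2 + s * z * q)) * (amp p * E t (2 * t * q + s * z) p))"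
    proof
      fix p
      have "iexp (- (t * (p - q)\<^sup>2)) * iexp (s * (p - q) * z)
          = iexp (- (t * q\<^sup>2 + s * z * q)) * E t (2 * t * q + s * z) p"
        unfolding E_def exp_add[symmetric] by (simp add: algebra_simps power2_eq_square)
      then show "f z p = iexp (- (t * q\<^sup>2 + s * z * q)) * (amp p * E t (2 * t * q + s * z) p)"
        by (simp add: f_def)
    qed
    show ?thesis unfolding eq osc_eq by (rule integral_mult_right_zero)
  qed
  then have inner: "norm (integral\<^sup>L lborel (f z)) \<le> C" for z
    using C by (simp only: norm_mult norm_exp_i_times mult_1)
  have outer: "(LINT z|?N. f z p) = amp p * exp (- ((1 + \<i>) * of_real (t * (p - q)\<^sup>2)))" for p
  proof -
    have "(LINT z|?N. f z p) = amp p * (iexp (- (t * (p - q)\<^sup>2)) * char ?N (s * (p - q)))"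
      by (simp add: f_def char_def)
    also have "char ?N (s * (p - q)) = of_real (gauss q t p)"
      by (simp add: char_std_normal_distribution gauss_def power_mult_distrib s2)
    finally show ?thesis unfolding exp_one_plus_ii by (simp add: mult.commute)
  qed
  have "gauss_avg q t = (LINT p|lborel. amp p * exp (- ((1 + \<i>) * of_real (t * (p - q)\<^sup>2))))"
    unfolding gauss_avg_def by (intro integral_amp continuous_intros)
  also have "\<dots> = (LINT p|lborel. (LINT z|?N. f z p))"
    by (simp only: outer)
  also have "\<dots> = (LINT z|?N. (LINT p|lborel. f z p))"
    by (rule P.Fubini_integral[OF f_int])
  also have "norm \<dots> \<le> (LINT z|?N. C)"
    by (intro Bochner_Integration.integral_norm_bound_integral P.integrable_fst f_int inner) simp
  also have "\<dots> = C" using N.prob_space by simp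
  finally show ?thesis .
qed

end

section \<open>Extended norms and the decay estimate for the solution\<close>

text \<open>The maximum of the norm of \<open>v\<close> may sit at an endpoint, while
  \<open>decay_const\<close> measures the open interval; density and continuity close the
  gap.\<close>

lemma norm_le_Linf_norm_Icc:
  fixes v :: "real \<Rightarrow> complex"
  assumes v: "continuous_on {a..b} v" and ab: "a < b" and p: "p \<in> {a..b}"
  shows "ennreal (norm (v p)) \<le> Linf_norm {a<..<b} v"
proof (cases "Linf_norm {a<..<b} v")
  case (real C)
  have "norm (v p) \<le> C"
  proof (rule continuous_on_closure_norm_le[of "{a<..<b}"])
    show "continuous_on (closure {a<..<b}) v" "p \<in> closure {a<..<b}"
      using v ab p by auto
    have "continuous_on {a<..<b} v" using v by (rule continuous_on_subset) auto
    then show "\<forall>y\<in>{a<..<b}. norm (v y) \<le> C"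
      using norm_le_Linf_norm[of "{a<..<b}" v] real by (auto simp: ennreal_le_iff)
  qed
  then show ?thesis by (simp add: real ennreal_leI)
qed simp

lemma L1_norm_eq_integral:
  assumes S: "S \<in> sets lebesgue" and f: "f absolutely_integrable_on S"
  shows "L1_norm S f = ennreal (integral S (\<lambda>x. norm (f x)))"
proof -
  have int: "integrable (lebesgue_on S) f"
    using f S by (subst integrable_restrict_space) (auto simp: set_integrable_def)
  then show ?thesis
    unfolding L1_norm_def using S
    by (subst nn_integral_eq_integral) (auto simp: lebesgue_integral_eq_integral)
qed

theorem theorem2p5:
  fixes \<mu> p1 p2 :: real
    and u0 :: "(real \<Rightarrow> complex) \<Rightarrow> complex"
    and Fu0 v :: "real \<Rightarrow> complex"
  assumes "0 < \<mu>" and "\<mu> \<le> 1" and "p1 < p2"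
    and "tempered_distribution u0"
    and "distribution_is_function (fourier_distribution u0) Fu0"
    and "distribution_support (fourier_distribution u0) = {p1..p2}"
    and "\<And>p. p \<in> {p1<..p2} \<Longrightarrow> Fu0 p = of_real ((p - p1) powr (\<mu> - 1)) * v p"
    and "continuous_on {p1..p2} v"
    and "\<And>p. p \<in> {p1<..<p2} \<Longrightarrow> v differentiable (at p)"
    and "(\<lambda>p. vector_derivative v (at p)) absolutely_integrable_on {p1<..<p2}"
    and "\<mu> \<noteq> 1 \<Longrightarrow> v p1 \<noteq> 0"
  shows "(\<forall>q1 q2 t. q1 < p1 \<longrightarrow> p2 < q2 \<longrightarrow> 1 \<le> t \<longrightarrow>
            Linf_norm UNIV (schroedinger_solution p1 p2 Fu0 t)
              \<le> decay_const \<mu> p1 p2 v q1 q2 * ennreal (t powr (- \<mu> / 2))) \<and>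
         \<not> ((\<lambda>t. ennreal (t powr (\<mu> / 2)) *
                Linf_norm UNIV (schroedinger_solution p1 p2 Fu0 t)) \<longlongrightarrow> 0) at_top"
proof -
  note \<mu> = assms(1,2) and p12 = assms(3)
  have "\<exists>p0\<in>{p1..p2}. \<forall>p\<in>{p1..p2}. norm (v p) \<le> norm (v p0)"
    using assms(3,8) by (intro continuous_attains_sup continuous_intros) auto
  then obtain p0 where p0: "p0 \<in> {p1..p2}" "\<And>p. p \<in> {p1..p2} \<Longrightarrow> norm (v p) \<le> norm (v p0)"
    by auto
  define M where "M = norm (v p0)"
  interpret singular_amplitude \<mu> p1 p2 v M
    by unfold_locales (use assms p0 in \<open>auto simp: M_def\<close>)
  have sol: "schroedinger_solution p1 p2 Fu0 t = (\<lambda>x. 1 / (2 * of_real pi) * osc t x)" for t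
  proof
    fix x
    let ?f = "\<lambda>p. w p *\<^sub>R v p * E t x p"
    let ?g = "\<lambda>p. Fu0 p * exp (- \<i> * of_real t * of_real p ^ 2 + \<i> * of_real x * of_real p)"
    \<comment> \<open>The hypothesis on \<open>Fu0\<close> says nothing at \<open>p1\<close>, a
      negligible point.\<close>
    have eq: "?g p = ?f p" if "p \<in> {p1..p2} - {p1}" for p
      using that assms(7)[of p] by (auto simp: w_def E_def scaleR_conv_of_real)
    have "?g absolutely_integrable_on {p1..p2}"
      by (rule absolutely_integrable_spike[OF integrable_wv_times[OF continuous_on_E], of "{p1}"])
         (use eq in auto)
    then have "(LINT p:{p1..p2}|lebesgue. ?g p) = integral {p1..p2} ?g"
      by (rule set_lebesgue_integral_eq_integral(2))
    also have "\<dots> = osc t x"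
      unfolding osc_def by (rule integral_spike[of "{p1}"]) (use eq in auto)
    finally show "schroedinger_solution p1 p2 Fu0 t x = 1 / (2 * of_real pi) * osc t x"
      by (simp add: schroedinger_solution_def)
  qed
  have sol_cont: "continuous_on UNIV (schroedinger_solution p1 p2 Fu0 t)" for t
    unfolding sol by (intro continuous_intros continuous_on_osc) auto
  have sol_le: "norm (schroedinger_solution p1 p2 Fu0 t x)
      \<le> (5 / (2 * pi * \<mu>) * M + 1 / (2 * pi) * (4 * M + L)) * t powr (- \<mu> / 2)" if t: "1 \<le> t" for t x
  proof -
    have "norm (osc t x) \<le> t powr (- \<mu> / 2) * (5 * M / \<mu> + 4 * M + L)"
      unfolding osc_def using t by (intro norm_integral_wvE_le) auto
    then have "1 / (2 * pi) * norm (osc t x) \<le> 1 / (2 * pi) * (t powr (- \<mu> / 2) * (5 * M / \<mu> + 4 * M + L))"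
      by (intro mult_left_mono) auto
    also have "\<dots> = (5 / (2 * pi * \<mu>) * M + 1 / (2 * pi) * (4 * M + L)) * t powr (- \<mu> / 2)"
      using \<mu> by (simp add: field_simps)
    finally show ?thesis by (simp add: sol norm_mult norm_divide)
  qed
  have L0: "0 \<le> L" unfolding L_def by (intro integral_nonneg) (use int_v' in \<open>auto simp: absolutely_integrable_on_def\<close>)
  have part1: "Linf_norm UNIV (schroedinger_solution p1 p2 Fu0 t)
              \<le> decay_const \<mu> p1 p2 v q1 q2 * ennreal (t powr (- \<mu> / 2))"
    if q: "q1 < p1" "p2 < q2" and t: "1 \<le> t" for q1 q2 t
  proof -
    let ?A = "5 / (2 * pi * \<mu>) * M + 1 / (2 * pi) * (4 * M + L)"
    have A0: "0 \<le> ?A" using \<mu> M_nonneg L0 by simp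
    have M_le: "ennreal M \<le> Linf_norm {p1<..<p2} v"
      unfolding M_def by (rule norm_le_Linf_norm_Icc[OF assms(8) p12 p0(1)])
    have L1: "L1_norm {p1<..<p2} (\<lambda>p. vector_derivative v (at p)) = ennreal L"
      unfolding L_def by (intro L1_norm_eq_integral int_v') auto
    have A: "ennreal ?A = ennreal (5 / (2 * pi * \<mu>)) * ennreal M + ennreal (1 / (2 * pi)) * (4 * ennreal M + ennreal L) * 1"
      using \<mu> M_nonneg L0 by (simp del: ennreal_plus flip: ennreal_mult ennreal_plus ennreal_numeral)
    \<comment> \<open>Both fractions are positive since \<open>q1 < p1\<close> and
      \<open>p2 < q2\<close>.\<close>
    have ge1: "1 \<le> ennreal (1 + 1 / (2 * (p1 - q1)) + 1 / (2 * (q2 - p2)))"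
      using q by (simp flip: ennreal_1 add: ennreal_leI)
    have "ennreal ?A \<le> decay_const \<mu> p1 p2 v q1 q2"
      unfolding decay_const_def L1 A by (intro add_mono mult_mono M_le ge1 order_refl) auto
    then have le: "ennreal (?A * t powr (- \<mu> / 2)) \<le> decay_const \<mu> p1 p2 v q1 q2 * ennreal (t powr (- \<mu> / 2))"
      using A0 by (simp add: ennreal_mult mult_right_mono)
    have "schroedinger_solution p1 p2 Fu0 t \<in> borel_measurable borel"
      using sol_cont by (rule borel_measurable_continuous_onI)
    then have "Linf_norm UNIV (schroedinger_solution p1 p2 Fu0 t) \<le> ennreal (?A * t powr (- \<mu> / 2))"
      unfolding Linf_norm_def lebesgue_on_UNIV_eq
      by (intro esssup_I AE_I2 ennreal_leI sol_le t) (auto intro!: measurable_completion)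
    from this le show ?thesis by (rule order_trans)
  qed
  \<comment> \<open>For \<open>\<mu> = 1\<close> the support supplies \<open>q\<close>: if
    \<open>v\<close> vanished on the open interval, the Fourier transform would vanish on all test
    functions supported there, so its support could not contain the midpoint.\<close>
  have "\<exists>q. p1 \<le> q \<and> q < p2 \<and> (q = p1 \<or> \<mu> = 1) \<and> v q \<noteq> 0"
  proof (cases "\<mu> = 1")
    case False
    then show ?thesis using assms(11) p12 by auto
  next
    case True
    show ?thesis
    proof (rule ccontr)
      assume contra: "\<not> ?thesis"
      have v0: "v p = 0" if "p \<in> {p1<..<p2}" for p
        using contra that True by auto
      have "fourier_distribution u0 f = 0" if f: "f \<in> test_functions {p1<..<p2}" for f
      proof -
        have "Fu0 p * f p = 0" for p
        proof (cases "p \<in> {p1<..<p2}")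
          case True
          then show ?thesis using assms(7)[of p] v0[of p] by simp
        next
          case False
          then have "p \<notin> {x. f x \<noteq> 0}"
            using f closure_subset[of "{x. f x \<noteq> 0}"] unfolding test_functions_def by blast
          then show ?thesis by simp
        qed
        then have "(\<lambda>p. Fu0 p * f p) = (\<lambda>p. 0)" by blast
        moreover have "f \<in> test_functions UNIV" using f by (auto simp: test_functions_def)
        ultimately show ?thesis
          using assms(5) by (simp add: distribution_is_function_def)
      qed
      then have "{p1<..<p2} \<subseteq> - distribution_support (fourier_distribution u0)"
        unfolding distribution_support_def by (auto intro!: exI[of _ "{p1<..<p2}"])
      moreover have "(p1 + p2) / 2 \<in> {p1<..<p2}" "(p1 + p2) / 2 \<in> {p1..p2}" using p12 by auto
      ultimately show False unfolding assms(6) by blast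
    qed
  qed
  then obtain q where q: "p1 \<le> q" "q < p2" "q = p1 \<or> \<mu> = 1" "v q \<noteq> 0" by auto
  from gauss_avg_lower_bound[OF q] obtain c where c: "0 < c"
    "eventually (\<lambda>t. c \<le> t powr (\<mu> / 2) * norm (gauss_avg q t)) at_top" by auto
  have avg_le: "ennreal (norm (gauss_avg q t) / (2 * pi)) \<le> Linf_norm UNIV (schroedinger_solution p1 p2 Fu0 t)"
    if t: "0 < t" for t
  \<comment> \<open>An infinite norm bounds anything. A finite one bounds every value of the
    continuous solution, and \<open>2 * pi\<close> undoes the normalization between
    \<open>osc\<close> and the solution.\<close>
  proof (cases "Linf_norm UNIV (schroedinger_solution p1 p2 Fu0 t)")
    case (real C)
    have "norm (osc t x) \<le> 2 * pi * C" for x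
    proof -
      have "ennreal (norm (schroedinger_solution p1 p2 Fu0 t x)) \<le> ennreal C"
        unfolding real(2)[symmetric] by (intro norm_le_Linf_norm sol_cont) auto
      then have "norm (schroedinger_solution p1 p2 Fu0 t x) \<le> C"
        using real(1) by (simp add: ennreal_le_iff)
      then show ?thesis by (simp add: sol norm_mult norm_divide field_simps)
    qed
    then have "norm (gauss_avg q t) \<le> 2 * pi * C" by (rule norm_gauss_avg_le[OF t])
    then show ?thesis unfolding real(2) by (intro ennreal_leI) (simp add: field_simps)
  qed simp
  have part2: "\<not> ((\<lambda>t. ennreal (t powr (\<mu> / 2)) *
                Linf_norm UNIV (schroedinger_solution p1 p2 Fu0 t)) \<longlongrightarrow> 0) at_top"
  proof
    assume "((\<lambda>t. ennreal (t powr (\<mu> / 2)) *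
                Linf_norm UNIV (schroedinger_solution p1 p2 Fu0 t)) \<longlongrightarrow> 0) at_top"
    moreover have "0 < ennreal (c / (2 * pi))" using c(1) by simp
    ultimately have "eventually (\<lambda>t. ennreal (t powr (\<mu> / 2)) *
                Linf_norm UNIV (schroedinger_solution p1 p2 Fu0 t) < ennreal (c / (2 * pi))) at_top"
      by (rule order_tendstoD)
    \<comment> \<open>Convergence to zero would push the scaled norm below the constant
      \<open>c / (2 * pi)\<close> that \<open>avg_le\<close> and \<open>c(2)\<close> guarantee for
      all large \<open>t\<close>.\<close>
    with c(2) eventually_gt_at_top[of 0] have "eventually (\<lambda>t::real. False) at_top"
    proof eventually_elim
      case (elim t)
      have "ennreal (c / (2 * pi)) \<le> ennreal (t powr (\<mu> / 2) * (norm (gauss_avg q t) / (2 * pi)))"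
        using elim(1) by (intro ennreal_leI) (simp add: divide_right_mono)
      also have "\<dots> \<le> ennreal (t powr (\<mu> / 2)) * Linf_norm UNIV (schroedinger_solution p1 p2 Fu0 t)"
        by (subst ennreal_mult) (auto intro!: mult_left_mono avg_le elim)
      finally show False using elim(3) by simp
    qed
    then show False by simp
  qed
  from part1 part2 show ?thesis by blast
qed

end
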